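(* Let $H$ and $H^*$ be the Hardy operator and the adjoint Hardy operator on $\mathbb{R}$, given by $$Hf(x)=\int_1^\infty \frac{1}{t^2}f\left(\frac{x}{t}\right)\mathrm{d}t=\frac1x\int_0^x f(t)\,\mathrm{d}t,\qquad H^*f(x)=\int_0^1\frac1t f\left(\frac{x}{t}\right)\mathrm{d}t \qquad (x\ne 0).$$ Then $H$ is not bounded on $W^{k,1}(\mathbb{R})$ for any integer $k\ge 0$. The operator $H^*$ is bounded on $L^1(\mathbb{R})$, but is not bounded on $W^{k,1}(\mathbb{R})$ for any positive integer $k$.
   Context: For an integer $k\ge 0$, $W^{k,1}(\mathbb{R})$ is the space of $f\in L^1(\mathbb{R})$ whose weak derivatives $f^{(j)}$ exist and belong to $L^1(\mathbb{R})$ for all $j\le k$, with norm $\|f\|_{W^{k,1}}=\sum_{j=0}^k\|f^{(j)}\|_{L^1}$ (so $W^{0,1}=L^1$). An operator $T$ is bounded on a normed function space $X$ if $Tf$ is defined almost everywhere (by an absolutely convergent integral) and belongs to $X$ for every $f\in X$, and there is a constant $C$ with $\|Tf\|_X\le C\|f\|_X$ for all $f\in X$. For $x>0$ one has $H^*f(x)=\int_x^\infty \frac{f(t)}{t}\,\mathrm{d}t$. *)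

theory Defs
  imports "HOL-Analysis.Analysis"
begin

text \<open>
  Elements of the spaces below are functions rather than almost-everywhere classes; no notion
  depends on the representative. The codomain \<open>'a\<close> is a normed field that is a finite-dimensional
  real inner product space, which includes \<^typ>\<open>real\<close> and \<^typ>\<open>complex\<close>.
\<close>

definition L1 :: "(real \<Rightarrow> 'a::{real_normed_field, euclidean_space}) set"
  where "L1 = {f. integrable lebesgue f}"

definition L1_norm :: "(real \<Rightarrow> 'a::{real_normed_field, euclidean_space}) \<Rightarrow> real"
  where "L1_norm f = (LINT x|lebesgue. norm (f x))"

definition locally_integrable :: "(real \<Rightarrow> 'a::{real_normed_field, euclidean_space}) \<Rightarrow> bool"
  where "locally_integrable f \<longleftrightarrow> (\<forall>a b. set_integrable lebesgue {a..b} f)"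

definition test_function :: "(real \<Rightarrow> real) \<Rightarrow> bool"
  where "test_function \<phi> \<longleftrightarrow>
    (\<forall>n x. (deriv ^^ n) \<phi> differentiable at x) \<and> compact (closure {x. \<phi> x \<noteq> 0})"

text \<open>
  Real-valued test functions suffice also for complex-valued \<open>f\<close>, as the defining identity is
  linear in \<open>\<phi>\<close>.
\<close>

definition has_weak_deriv ::
    "nat \<Rightarrow> (real \<Rightarrow> 'a::{real_normed_field, euclidean_space}) \<Rightarrow> (real \<Rightarrow> 'a) \<Rightarrow> bool"
  where "has_weak_deriv j f g \<longleftrightarrow> locally_integrable f \<and> locally_integrable g \<and>
    (\<forall>\<phi>. test_function \<phi> \<longrightarrow>
      (LINT x|lebesgue. (deriv ^^ j) \<phi> x *\<^sub>R f x) =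
      (- 1) ^ j *\<^sub>R (LINT x|lebesgue. \<phi> x *\<^sub>R g x))"

text \<open>
  Weak derivatives are unique up to a null set, so the choice below does not affect the norm.
\<close>

definition weak_deriv ::
    "nat \<Rightarrow> (real \<Rightarrow> 'a::{real_normed_field, euclidean_space}) \<Rightarrow> real \<Rightarrow> 'a"
  where "weak_deriv j f = (SOME g. has_weak_deriv j f g)"

definition sobolev_W1 :: "nat \<Rightarrow> (real \<Rightarrow> 'a::{real_normed_field, euclidean_space}) set"
  where "sobolev_W1 k = {f \<in> L1. \<forall>j\<le>k. \<exists>g\<in>L1. has_weak_deriv j f g}"

definition sobolev_W1_norm ::
    "nat \<Rightarrow> (real \<Rightarrow> 'a::{real_normed_field, euclidean_space}) \<Rightarrow> real"
  where "sobolev_W1_norm k f = (\<Sum>j\<le>k. L1_norm (weak_deriv j f))"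

text \<open>
  An operator sends \<open>f\<close> to a partial function on the line, undefined where the defining integral
  does not converge absolutely. In a bounded operator this happens on a null set only, where the
  value of \<^term>\<open>the\<close> is irrelevant.
\<close>

definition bounded_operator_on ::
    "(real \<Rightarrow> 'a::{real_normed_field, euclidean_space}) set \<Rightarrow> ((real \<Rightarrow> 'a) \<Rightarrow> real) \<Rightarrow>
     ((real \<Rightarrow> 'a) \<Rightarrow> real \<Rightarrow> 'a option) \<Rightarrow> bool"
  where "bounded_operator_on X N T \<longleftrightarrow>
    (\<forall>f\<in>X. (AE x in lebesgue. T f x \<noteq> None) \<and> (\<lambda>x. the (T f x)) \<in> X) \<and>
    (\<exists>C. \<forall>f\<in>X. N (\<lambda>x. the (T f x)) \<le> C * N f)"

definition hardy ::
    "(real \<Rightarrow> 'a::{real_normed_field, euclidean_space}) \<Rightarrow> real \<Rightarrow> 'a option"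
  where "hardy f x =
    (if x \<noteq> 0 \<and> set_integrable lebesgue {1<..} (\<lambda>t. (1 / t\<^sup>2) *\<^sub>R f (x / t))
     then Some (LINT t:{1<..}|lebesgue. (1 / t\<^sup>2) *\<^sub>R f (x / t)) else None)"

definition adjoint_hardy ::
    "(real \<Rightarrow> 'a::{real_normed_field, euclidean_space}) \<Rightarrow> real \<Rightarrow> 'a option"
  where "adjoint_hardy f x =
    (if x \<noteq> 0 \<and> set_integrable lebesgue {0<..<1} (\<lambda>t. (1 / t) *\<^sub>R f (x / t))
     then Some (LINT t:{0<..<1}|lebesgue. (1 / t) *\<^sub>R f (x / t)) else None)"

end

theory Submission
  imports Defs
begin

text \<open>
  The substitution \<open>s = x / t\<close> turns \<open>Hf(x)\<close> into the mean of \<open>f\<close> over \<open>(0, x)\<close> and, for \<open>x > 0\<close>,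
  \<open>H\<^sup>*f(x)\<close> into the integral of \<open>f(s) / s\<close> over \<open>(x, \<infinity>)\<close>. Since the kernel of \<open>H\<^sup>*\<close> has integral 1
  in \<open>x\<close>, Fubini's theorem bounds \<open>H\<^sup>*\<close> on \<open>L\<^sup>1\<close> with constant 1. Both negative results come from
  \<open>f(x) = 1 / (1 + x\<^sup>2)\<close>, which lies in every \<open>W\<^sup>k\<^sup>,\<^sup>1\<close>. First, \<open>Hf(x) = arctan x / x\<close> is not integrable at
  infinity. Second, on \<open>(0, \<infinity>)\<close> the derivative of \<open>H\<^sup>*f\<close> is \<open>- 1 / (x (1 + x\<^sup>2))\<close>, which is not
  integrable at 0. To reach a contradiction from a weak derivative \<open>g \<in> L\<^sup>1\<close> of \<open>H\<^sup>*f\<close>, test it against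
  dilations \<open>\<psi>(n x)\<close> of a bump \<open>\<psi>\<close> supported in \<open>[1, 2]\<close>: the integrals of \<open>\<psi>(n x) g(x)\<close> tend to 0 by
  dominated convergence, while integration by parts bounds their norms away from 0.
\<close>

section \<open>The substitution \<open>s = x / t\<close>\<close>

text \<open>The absolute value of the derivative of \<open>t \<mapsto> x / t\<close> is
  \<open>\<bar>x\<bar> / t\<^sup>2\<close>, so this is the change of variables formula. A general
  set \<open>S\<close> away from 0 covers the domains of both operators and both signs of
  \<open>x\<close>.\<close>

lemma reciprocal_substitution:
  fixes F :: "real \<Rightarrow> 'a::euclidean_space"
  assumes S: "S \<in> sets lebesgue" "0 \<notin> S" and "x \<noteq> 0"
    and F: "set_integrable lebesgue ((\<lambda>t. x / t) ` S) F"
  shows "set_integrable lebesgue S (\<lambda>t. (\<bar>x\<bar> / t\<^sup>2) *\<^sub>R F (x / t))"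
    and "(LINT t:S|lebesgue. (\<bar>x\<bar> / t\<^sup>2) *\<^sub>R F (x / t)) = (LINT s:(\<lambda>t. x / t) ` S|lebesgue. F s)"
proof -
  have der: "((\<lambda>t. x / t) has_field_derivative - (x / t\<^sup>2)) (at t within S)" if "t \<in> S" for t
  proof -
    have "t \<noteq> 0" using that S by auto
    then show ?thesis
      by (auto intro!: derivative_eq_intros simp: power2_eq_square field_simps)
  qed
  have inj: "inj_on (\<lambda>t. x / t) S"
    using S \<open>x \<noteq> 0\<close> by (intro inj_onI) (metis divide_divide_eq_right nonzero_mult_div_cancel_left times_divide_eq_right)
  have eq: "(\<lambda>t. \<bar>- (x / t\<^sup>2)\<bar> *\<^sub>R F (x / t)) = (\<lambda>t. (\<bar>x\<bar> / t\<^sup>2) *\<^sub>R F (x / t))"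
    by simp
  have "set_integrable lebesgue S (\<lambda>t. (\<bar>x\<bar> / t\<^sup>2) *\<^sub>R F (x / t)) \<and>
      integral S (\<lambda>t. (\<bar>x\<bar> / t\<^sup>2) *\<^sub>R F (x / t)) = integral ((\<lambda>t. x / t) ` S) F"
    using iffD2[OF has_absolute_integral_change_of_variables_real[OF S(1) der inj] conjI[OF F refl]]
    unfolding eq .
  then show int: "set_integrable lebesgue S (\<lambda>t. (\<bar>x\<bar> / t\<^sup>2) *\<^sub>R F (x / t))"
    and "(LINT t:S|lebesgue. (\<bar>x\<bar> / t\<^sup>2) *\<^sub>R F (x / t)) = (LINT s:(\<lambda>t. x / t) ` S|lebesgue. F s)"
    by (simp_all add: set_lebesgue_integral_eq_integral(2)[OF F] set_lebesgue_integral_eq_integral(2))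
qed

text \<open>The map \<open>t \<mapsto> x / t\<close> is an involution, so \<open>x / s\<close> is
  the preimage of \<open>s\<close>.\<close>

lemma divide_image_greaterThan_1:
  fixes x :: real
  shows "x > 0 \<Longrightarrow> (\<lambda>t. x / t) ` {1<..} = {0<..<x}"
    and "x < 0 \<Longrightarrow> (\<lambda>t. x / t) ` {1<..} = {x<..<0}"
proof -
  show "(\<lambda>t. x / t) ` {1<..} = {0<..<x}" if "x > 0"
  proof (intro set_eqI iffI)
    fix s assume "s \<in> {0<..<x}"
    then show "s \<in> (\<lambda>t. x / t) ` {1<..}"
      using that by (intro image_eqI[of _ _ "x / s"]) (auto simp: field_simps)
  qed (use that in \<open>auto simp: field_simps\<close>)
  show "(\<lambda>t. x / t) ` {1<..} = {x<..<0}" if "x < 0"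
  proof (intro set_eqI iffI)
    fix s assume "s \<in> {x<..<0}"
    then show "s \<in> (\<lambda>t. x / t) ` {1<..}"
      using that by (intro image_eqI[of _ _ "x / s"]) (auto simp: field_simps)
  qed (use that in \<open>auto simp: field_simps\<close>)
qed

lemma divide_image_unit_interval:
  fixes x :: real
  shows "x > 0 \<Longrightarrow> (\<lambda>t. x / t) ` {0<..<1} = {x<..}"
    and "x < 0 \<Longrightarrow> (\<lambda>t. x / t) ` {0<..<1} = {..<x}"
proof -
  show "(\<lambda>t. x / t) ` {0<..<1} = {x<..}" if "x > 0"
  proof (intro set_eqI iffI)
    fix s assume "s \<in> {x<..}"
    then show "s \<in> (\<lambda>t. x / t) ` {0<..<1}"
      using that by (intro image_eqI[of _ _ "x / s"]) (auto simp: field_simps)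
  qed (use that in \<open>auto simp: field_simps\<close>)
  show "(\<lambda>t. x / t) ` {0<..<1} = {..<x}" if "x < 0"
  proof (intro set_eqI iffI)
    fix s assume "s \<in> {..<x}"
    then show "s \<in> (\<lambda>t. x / t) ` {0<..<1}"
      using that by (intro image_eqI[of _ _ "x / s"]) (auto simp: field_simps)
  qed (use that in \<open>auto simp: field_simps\<close>)
qed

lemma hardy_eq_average:
  fixes f :: "real \<Rightarrow> 'a::{real_normed_field, euclidean_space}"
  assumes x: "x \<noteq> 0" and f: "interval_lebesgue_integrable lebesgue 0 (ereal x) f"
  shows "hardy f x = Some ((1 / x) *\<^sub>R interval_lebesgue_integral lebesgue 0 (ereal x) f)"
proof -
  let ?J = "(\<lambda>t. x / t) ` {1<..}"
  \<comment> \<open>For negative \<open>x\<close> the oriented integral from 0 to \<open>x\<close>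
    is minus the integral over \<open>(x, 0)\<close>. The factor \<open>sgn x\<close> records this
    and later turns \<open>1 / \<bar>x\<bar>\<close> into \<open>1 / x\<close>.\<close>
  have J: "set_integrable lebesgue ?J f"
    "(LINT s:?J|lebesgue. f s) = sgn x *\<^sub>R interval_lebesgue_integral lebesgue 0 (ereal x) f"
    using f x divide_image_greaterThan_1[of x]
    by (cases "x > 0"; simp add: interval_lebesgue_integrable_def interval_lebesgue_integral_def zero_ereal_def)+
  note sub = reciprocal_substitution[OF _ _ x J(1)]
  have eq: "(1 / t\<^sup>2) *\<^sub>R f (x / t) = (1 / \<bar>x\<bar>) *\<^sub>R (\<bar>x\<bar> / t\<^sup>2) *\<^sub>R f (x / t)" for t
    using x by simp
  have "set_integrable lebesgue {1<..} (\<lambda>t. (1 / t\<^sup>2) *\<^sub>R f (x / t))"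
    unfolding eq using sub(1) by (intro set_integrable_scaleR_right) auto
  moreover have "(LINT t:{1<..}|lebesgue. (1 / t\<^sup>2) *\<^sub>R f (x / t))
      = (1 / \<bar>x\<bar>) *\<^sub>R (LINT s:?J|lebesgue. f s)"
    unfolding eq set_integral_scaleR_right by (subst sub(2)) simp_all
  ultimately show ?thesis
    using x by (simp add: hardy_def J(2) sgn_if)
qed

section \<open>The adjoint Hardy operator on integrable functions\<close>

text \<open>
  The substitution \<open>s = x / t\<close> turns \<open>H\<^sup>*\<close> into the integral operator with this kernel.
\<close>

definition adjoint_kernel :: "real \<Rightarrow> real \<Rightarrow> real"
  where "adjoint_kernel x s = (if 0 < x \<and> x < s \<or> s < x \<and> x < 0 then 1 / \<bar>s\<bar> else 0)"

lemma adjoint_kernel_nonneg: "adjoint_kernel x s \<ge> 0"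
  by (simp add: adjoint_kernel_def)

text \<open>The kernel lives where \<open>\<bar>s\<bar> > \<bar>x\<bar>\<close>. This bound makes
  the adjoint integral of an integrable function converge at every nonzero \<open>x\<close>.\<close>

lemma adjoint_kernel_le: "x \<noteq> 0 \<Longrightarrow> adjoint_kernel x s \<le> 1 / \<bar>x\<bar>"
  by (auto simp: adjoint_kernel_def field_simps)

lemma borel_measurable_adjoint_kernel [measurable]:
  "(\<lambda>(x, s). adjoint_kernel x s) \<in> borel_measurable (borel \<Otimes>\<^sub>M borel)"
  unfolding adjoint_kernel_def by measurable

text \<open>In the variable \<open>x\<close> the kernel is the constant
  \<open>1 / \<bar>s\<bar>\<close> on an interval of length \<open>\<bar>s\<bar>\<close>.\<close>

lemma adjoint_kernel_integral:
  assumes "s \<noteq> 0"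
  shows "has_bochner_integral lborel (\<lambda>x. adjoint_kernel x s) 1"
proof -
  have "has_bochner_integral lborel (\<lambda>x. indicator (if s > 0 then {0<..<s} else {s<..<0}) x *\<^sub>R (1 / \<bar>s\<bar>))
     (measure lborel (if s > 0 then {0<..<s} else {s<..<0}) *\<^sub>R (1 / \<bar>s\<bar>))"
    by (intro has_bochner_integral_indicator) auto
  moreover have "(\<lambda>x. indicator (if s > 0 then {0<..<s} else {s<..<0}) x *\<^sub>R (1 / \<bar>s\<bar>))
      = (\<lambda>x. adjoint_kernel x s)"
    by (auto simp: adjoint_kernel_def fun_eq_iff indicator_def)
  moreover have "measure lborel (if s > 0 then {0<..<s} else {s<..<0}) *\<^sub>R (1 / \<bar>s\<bar>) = (1::real)"
    using assms by simp
  ultimately show ?thesis by metis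
qed

lemma adjoint_kernel_integrable:
  fixes f :: "real \<Rightarrow> 'a::{real_normed_field, euclidean_space}"
  assumes f: "integrable lebesgue f" and x: "x \<noteq> 0"
  shows "integrable lebesgue (\<lambda>s. adjoint_kernel x s *\<^sub>R f s)"
proof (rule Bochner_Integration.integrable_bound)
  show "integrable lebesgue (\<lambda>s. (1 / \<bar>x\<bar>) *\<^sub>R f s)"
    using f by simp
  have [measurable]: "(\<lambda>s. adjoint_kernel x s) \<in> borel_measurable borel"
    by measurable
  have "(\<lambda>s. adjoint_kernel x s) \<in> borel_measurable lebesgue"
    by (rule measurable_completion) simp
  then show "(\<lambda>s. adjoint_kernel x s *\<^sub>R f s) \<in> borel_measurable lebesgue"
    using f by (intro borel_measurable_scaleR) auto
  show "AE s in lebesgue. norm (adjoint_kernel x s *\<^sub>R f s) \<le> norm ((1 / \<bar>x\<bar>) *\<^sub>R f s)"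
    using adjoint_kernel_le[OF x] adjoint_kernel_nonneg[of x]
    by (auto intro!: AE_I2 mult_right_mono simp del: times_divide_eq_left)
qed

lemma adjoint_hardy_eq_kernel:
  fixes f :: "real \<Rightarrow> 'a::{real_normed_field, euclidean_space}"
  assumes f: "integrable lebesgue f" and x: "x \<noteq> 0"
  shows "adjoint_hardy f x = Some (LINT s|lebesgue. adjoint_kernel x s *\<^sub>R f s)"
proof -
  let ?J = "(\<lambda>t. x / t) ` {0<..<1}" and ?F = "\<lambda>s. (1 / \<bar>s\<bar>) *\<^sub>R f s"
  have eq: "indicator ?J s *\<^sub>R ?F s = adjoint_kernel x s *\<^sub>R f s" for s
    using x divide_image_unit_interval[of x] by (cases "x > 0") (auto simp: adjoint_kernel_def indicator_def)
  have J: "set_integrable lebesgue ?J ?F"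
    unfolding set_integrable_def eq by (rule adjoint_kernel_integrable[OF f x])
  have S: "{0<..<1::real} \<in> sets lebesgue" "(0::real) \<notin> {0<..<1}"
    by auto
  note sub = reciprocal_substitution[OF S x J]
  \<comment> \<open>The weights multiply to \<open>\<bar>t\<bar> / t\<^sup>2\<close>, which is
    \<open>1 / t\<close> only for positive \<open>t\<close>; hence the indicator stays on both
    sides.\<close>
  have eq': "indicator {0<..<1} t *\<^sub>R (\<bar>x\<bar> / t\<^sup>2) *\<^sub>R (1 / \<bar>x / t\<bar>) *\<^sub>R f (x / t)
      = indicator {0<..<1} t *\<^sub>R (1 / t) *\<^sub>R f (x / t)" for t
    using x by (simp add: indicator_def power2_eq_square)
  have "set_integrable lebesgue {0<..<1} (\<lambda>t. (1 / t) *\<^sub>R f (x / t))"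
    using sub(1) unfolding set_integrable_def eq' .
  moreover have "(LINT t:{0<..<1}|lebesgue. (1 / t) *\<^sub>R f (x / t)) = (LINT s|lebesgue. adjoint_kernel x s *\<^sub>R f s)"
    using sub(2) unfolding set_lebesgue_integral_def eq' eq .
  ultimately show ?thesis
    using x by (simp add: adjoint_hardy_def)
qed

section \<open>Boundedness on integrable functions by Fubini's theorem\<close>

text \<open>Each of the finitely many coordinates has a Borel representative. Fubini's theorem is
  applied on the product of Borel measures, where joint measurability calls for such a
  representative.\<close>

lemma lebesgue_measurable_borel_representative:
  fixes f :: "'b::euclidean_space \<Rightarrow> 'a::euclidean_space"
  assumes f: "f \<in> borel_measurable lebesgue"
  obtains g where "g \<in> borel_measurable lborel" "AE x in lborel. f x = g x"
proof -
  have "\<exists>g. g \<in> borel_measurable lborel \<and> (AE x in lborel. f x \<bullet> b = g x)" for b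
    using completion_ex_borel_measurable_real[of "\<lambda>x. f x \<bullet> b" lborel] f by auto
  then obtain g where g: "\<And>b. g b \<in> borel_measurable lborel" "\<And>b. AE x in lborel. f x \<bullet> b = g b x"
    by metis
  have "AE x in lborel. \<forall>b\<in>Basis. f x \<bullet> b = g b x"
    using g(2) by (intro AE_finite_allI) auto
  then have "AE x in lborel. f x = (\<Sum>b\<in>Basis. g b x *\<^sub>R b)"
    by eventually_elim (metis (no_types, lifting) euclidean_representation sum.cong)
  moreover have "(\<lambda>x. \<Sum>b\<in>Basis. g b x *\<^sub>R b) \<in> borel_measurable lborel"
    using g(1) by measurable
  ultimately show ?thesis using that by blast
qed

text \<open>Integrating the norm in \<open>x\<close> first leaves exactly \<open>norm (f s)\<close>,
  because the kernel has mass 1. This gives joint integrability, and then exchanging the order of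
  integration gives the estimate.\<close>

lemma adjoint_kernel_L1:
  fixes f :: "real \<Rightarrow> 'a::{real_normed_field, euclidean_space}"
  assumes f: "integrable lborel f"
  defines "u \<equiv> \<lambda>x. LINT s|lborel. adjoint_kernel x s *\<^sub>R f s"
  shows "integrable lborel u" and "(LINT x|lborel. norm (u x)) \<le> (LINT x|lborel. norm (f x))"
proof -
  have [measurable]: "f \<in> borel_measurable borel"
    using f by auto
  have k: "has_bochner_integral lborel (\<lambda>x. norm (adjoint_kernel x s *\<^sub>R f s)) (norm (f s))"
    if "s \<noteq> 0" for s
    using has_bochner_integral_mult_left[OF adjoint_kernel_integral[OF that], of "norm (f s)"]
    by (simp add: adjoint_kernel_nonneg)
  have ae: "AE s in lborel. s \<noteq> (0::real)"
    by (rule AE_lborel_singleton)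
  have int: "integrable (lborel \<Otimes>\<^sub>M lborel) (\<lambda>(s, x). adjoint_kernel x s *\<^sub>R f s)"
  proof (rule lborel_pair.Fubini_integrable)
    show "(\<lambda>(s, x). adjoint_kernel x s *\<^sub>R f s) \<in> borel_measurable (lborel \<Otimes>\<^sub>M lborel)"
      by measurable
    have "integrable lborel (\<lambda>s. LINT x|lborel. norm (adjoint_kernel x s *\<^sub>R f s)) \<longleftrightarrow> integrable lborel (\<lambda>s. norm (f s))"
    proof (rule integrable_cong_AE)
      show "AE s in lborel. (LINT x|lborel. norm (adjoint_kernel x s *\<^sub>R f s)) = norm (f s)"
        using ae by eventually_elim (rule has_bochner_integral_integral_eq[OF k])
    qed measurable
    then show "integrable lborel (\<lambda>s. LINT x|lborel. norm (case (s, x) of (s, x) \<Rightarrow> adjoint_kernel x s *\<^sub>R f s))"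
      using f by simp
    show "AE s in lborel. integrable lborel (\<lambda>x. case (s, x) of (s, x) \<Rightarrow> adjoint_kernel x s *\<^sub>R f s)"
      using ae
    proof eventually_elim
      case (elim s)
      show ?case
        using has_bochner_integral_scaleR_left[OF adjoint_kernel_integral[OF elim], of "f s"]
        by (auto intro: integrable.intros)
    qed
  qed
  have int': "integrable (lborel \<Otimes>\<^sub>M lborel) (\<lambda>(x, s). adjoint_kernel x s *\<^sub>R f s)"
    using lborel_pair.integrable_product_swap[OF int] by simp
  show u: "integrable lborel u"
    using lborel_pair.integrable_fst'[OF int'] by (simp add: u_def)
  have intn: "integrable (lborel \<Otimes>\<^sub>M lborel) (\<lambda>(x, s). norm (adjoint_kernel x s *\<^sub>R f s))"
    using integrable_norm[OF int'] by (simp add: case_prod_unfold)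
  have "(LINT x|lborel. norm (u x)) \<le> (LINT x|lborel. LINT s|lborel. norm (adjoint_kernel x s *\<^sub>R f s))"
    using lborel_pair.integrable_fst'[OF intn] u unfolding u_def
    by (intro integral_mono integral_norm_bound integrable_norm) auto
  also have "\<dots> = (LINT s|lborel. LINT x|lborel. norm (adjoint_kernel x s *\<^sub>R f s))"
    by (rule lborel_pair.Fubini_integral[OF intn, symmetric])
  also have "\<dots> = (LINT s|lborel. norm (f s))"
  proof (rule integral_cong_AE)
    show "AE s in lborel. (LINT x|lborel. norm (adjoint_kernel x s *\<^sub>R f s)) = norm (f s)"
      using ae by eventually_elim (rule has_bochner_integral_integral_eq[OF k])
  qed measurable
  finally show "(LINT x|lborel. norm (u x)) \<le> (LINT x|lborel. norm (f x))" .
qed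

text \<open>Replacing \<open>f\<close> by a Borel representative changes the inner integral at no
  nonzero \<open>x\<close>. The Borel estimate then transfers to the completed measure, with
  constant 1.\<close>

lemma adjoint_hardy_bounded_L1:
  "bounded_operator_on L1 L1_norm
     (adjoint_hardy :: (real \<Rightarrow> 'a::{real_normed_field, euclidean_space}) \<Rightarrow> real \<Rightarrow> 'a option)"
proof -
  have "(AE x in lebesgue. adjoint_hardy f x \<noteq> None) \<and> (\<lambda>x. the (adjoint_hardy f x)) \<in> L1 \<and>
    L1_norm (\<lambda>x. the (adjoint_hardy f x)) \<le> L1_norm f"
    if "f \<in> L1" for f :: "real \<Rightarrow> 'a"
  proof -
    have f: "integrable lebesgue f"
      using that by (simp add: L1_def)
    obtain g where gm: "g \<in> borel_measurable lborel" and g: "AE x in lborel. f x = g x"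
      by (rule lebesgue_measurable_borel_representative[OF borel_measurable_integrable[OF f]])
    have gm' [measurable]: "g \<in> borel_measurable lebesgue" "g \<in> borel_measurable borel"
      using gm measurable_completion[OF gm] by simp_all
    have fm [measurable]: "f \<in> borel_measurable lebesgue"
      using f by (rule borel_measurable_integrable)
    have fg: "AE x in lebesgue. f x = g x"
      using g by (rule AE_completion)
    have "integrable lebesgue g"
      using f integrable_cong_AE[OF fm gm'(1) fg] by simp
    then have gi: "integrable lborel g"
      using gm by (simp add: integrable_completion)
    define u where "u = (\<lambda>x. LINT s|lborel. adjoint_kernel x s *\<^sub>R g s)"
    have eq: "adjoint_hardy f x = Some (u x)" if "x \<noteq> 0" for x
    proof -
      have kx [measurable]: "adjoint_kernel x \<in> borel_measurable borel"
        by measurable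
      have [measurable]: "adjoint_kernel x \<in> borel_measurable lebesgue"
        by (rule measurable_completion) (simp add: kx)
      have "(LINT s|lebesgue. adjoint_kernel x s *\<^sub>R f s) = (LINT s|lebesgue. adjoint_kernel x s *\<^sub>R g s)"
      proof (rule integral_cong_AE)
        show "AE s in lebesgue. adjoint_kernel x s *\<^sub>R f s = adjoint_kernel x s *\<^sub>R g s"
          using fg by eventually_elim simp
      qed (intro borel_measurable_scaleR; measurable)+
      also have "\<dots> = u x"
        unfolding u_def by (rule integral_completion) measurable
      finally show ?thesis
        using adjoint_hardy_eq_kernel[OF f that] by simp
    qed
    have u: "integrable lborel u" "(LINT x|lborel. norm (u x)) \<le> (LINT x|lborel. norm (g x))"
      unfolding u_def by (rule adjoint_kernel_L1[OF gi])+
    have um: "u \<in> borel_measurable lborel"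
      by (rule borel_measurable_integrable[OF u(1)])
    have ul: "integrable lebesgue u"
      using u um by (simp add: integrable_completion)
    have [measurable]: "u \<in> borel_measurable lebesgue"
      by (rule borel_measurable_integrable[OF ul])
    have ae0: "AE x in lebesgue. x \<noteq> (0::real)"
      by (intro AE_completion AE_lborel_singleton)
    have aeu: "AE x in lebesgue. u x = the (adjoint_hardy f x)"
      using ae0 by eventually_elim (simp add: eq)
    have hm [measurable]: "(\<lambda>x. the (adjoint_hardy f x)) \<in> borel_measurable lebesgue"
      by (rule borel_measurable_AE[OF borel_measurable_integrable[OF ul] aeu])
    have "integrable lebesgue (\<lambda>x. the (adjoint_hardy f x))"
      using integrable_cong_AE[OF borel_measurable_integrable[OF ul] hm aeu] ul by simp
    moreover have "L1_norm (\<lambda>x. the (adjoint_hardy f x)) \<le> L1_norm f"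
    proof -
      have "L1_norm (\<lambda>x. the (adjoint_hardy f x)) = (LINT x|lebesgue. norm (u x))"
        unfolding L1_norm_def
      proof (rule integral_cong_AE)
        show "AE x in lebesgue. norm (the (adjoint_hardy f x)) = norm (u x)"
          using aeu by eventually_elim simp
      qed measurable
      also have "\<dots> = (LINT x|lborel. norm (u x))"
        by (rule integral_completion) (use um in measurable)
      also have "\<dots> \<le> (LINT x|lborel. norm (g x))"
        by (rule u(2))
      also have "\<dots> = (LINT x|lebesgue. norm (g x))"
        by (rule integral_completion[symmetric]) measurable
      also have "\<dots> = L1_norm f"
        unfolding L1_norm_def
      proof (rule integral_cong_AE)
        show "AE x in lebesgue. norm (g x) = norm (f x)"
          using fg by eventually_elim simp
      qed measurable
      finally show ?thesis .
    qed
    moreover have "AE x in lebesgue. adjoint_hardy f x \<noteq> None"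
      using ae0 by eventually_elim (simp add: eq)
    ultimately show ?thesis
      by (simp add: L1_def)
  qed
  then show ?thesis
    by (auto simp: bounded_operator_on_def intro!: exI[of _ 1])
qed

section \<open>Smooth bump functions\<close>

text \<open>The polynomial is a parameter in order to make the family closed under
  differentiation.\<close>

definition flat_exp :: "real poly \<Rightarrow> real \<Rightarrow> real"
  where "flat_exp p x = (if x > 0 then poly p (1 / x) * exp (- 1 / x) else 0)"

lemma poly_times_exp_minus_tendsto_0:
  fixes p :: "real poly"
  shows "((\<lambda>y. poly p y * exp (- y)) \<longlongrightarrow> 0) at_top"
proof -
  have "((\<lambda>y. \<Sum>i\<le>degree p. coeff p i * (y ^ i / exp y)) \<longlongrightarrow> (\<Sum>i\<le>degree p. coeff p i * 0)) at_top"
    by (intro tendsto_intros tendsto_power_div_exp_0)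
  then show ?thesis
    by (simp add: poly_altdef sum_distrib_right exp_minus field_simps sum_divide_distrib)
qed

text \<open>For positive \<open>x\<close>, both terms of the product rule carry the factor
  \<open>1 / x\<^sup>2\<close>; \<open>[:0, 0, 1:]\<close> is this factor as the polynomial
  \<open>y\<^sup>2\<close> in \<open>y = 1 / x\<close>. At 0 the one-sided difference quotients are
  examined directly.\<close>

lemma flat_exp_has_derivative:
  "(flat_exp p has_real_derivative flat_exp ([:0, 0, 1:] * (p - pderiv p)) x) (at x)"
proof -
  consider "x > 0" | "x < 0" | "x = 0" by linarith
  then show ?thesis
  proof cases
    case 1
    have "((\<lambda>x. poly p (1 / x) * exp (- 1 / x)) has_real_derivative
        flat_exp ([:0, 0, 1:] * (p - pderiv p)) x) (at x)"
      using 1 by (auto intro!: derivative_eq_intros poly_DERIV[THEN DERIV_chain2]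
        simp: flat_exp_def power2_eq_square field_simps)
    then show ?thesis
      by (rule has_field_derivative_transform_within_open[where S = "{0<..}"])
        (use 1 in \<open>auto simp: flat_exp_def\<close>)
  next
    case 2
    have "((\<lambda>x. 0) has_real_derivative flat_exp ([:0, 0, 1:] * (p - pderiv p)) x) (at x)"
      using 2 by (simp add: flat_exp_def)
    then show ?thesis
      by (rule has_field_derivative_transform_within_open[where S = "{..<0}"])
        (use 2 in \<open>auto simp: flat_exp_def\<close>)
  next
    case 3
    \<comment> \<open>Multiplying \<open>p\<close> by its variable accounts for the division by
      \<open>h\<close> in the difference quotient.\<close>
    have "((\<lambda>h. poly (pCons 0 p) (inverse h) * exp (- inverse h)) \<longlongrightarrow> 0) (at_right 0)"
      using filterlim_compose[OF poly_times_exp_minus_tendsto_0 filterlim_inverse_at_top_right, of "pCons 0 p"]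
      by simp
    then have "((\<lambda>h. flat_exp p h / h) \<longlongrightarrow> 0) (at_right 0)"
      by (rule Lim_transform_eventually)
        (auto simp: flat_exp_def eventually_at_right_field field_simps intro!: exI[of _ 1])
    moreover have "((\<lambda>h. flat_exp p h / h) \<longlongrightarrow> 0) (at_left 0)"
      by (rule Lim_transform_eventually[OF tendsto_const])
        (auto simp: flat_exp_def eventually_at_left_field intro!: exI[of _ "-1"])
    ultimately have "((\<lambda>h. flat_exp p h / h) \<longlongrightarrow> 0) (at 0)"
      by (simp add: filterlim_split_at_real)
    then show ?thesis
      using 3 by (simp add: DERIV_def flat_exp_def)
  qed
qed

text \<open>
  A set of functions containing a derivative of each of its members consists of smooth functions;
  this replaces a Leibniz rule for iterated derivatives.
\<close>

inductive_set bump_span :: "real \<Rightarrow> (real \<Rightarrow> real) set" for c where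
  product: "(\<lambda>x. flat_exp p (c * x - 1) * flat_exp q (2 - c * x)) \<in> bump_span c"
| add: "f \<in> bump_span c \<Longrightarrow> g \<in> bump_span c \<Longrightarrow> (\<lambda>x. f x + g x) \<in> bump_span c"

text \<open>The product rule yields two products of the same shape; the chain rule factors
  \<open>c\<close> and \<open>- c\<close> are absorbed into the polynomials.\<close>

lemma bump_span_has_derivative:
  "f \<in> bump_span c \<Longrightarrow> \<exists>f'\<in>bump_span c. \<forall>x. (f has_real_derivative f' x) (at x)"
proof (induction rule: bump_span.induct)
  case (product p q)
  define D where "D = (\<lambda>p :: real poly. [:0, 0, 1:] * (p - pderiv p))"
  define f' where "f' = (\<lambda>x. flat_exp (smult c (D p)) (c * x - 1) * flat_exp q (2 - c * x)
    + flat_exp p (c * x - 1) * flat_exp (smult (- c) (D q)) (2 - c * x))"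
  have "f' \<in> bump_span c"
    unfolding f'_def by (intro bump_span.add bump_span.product)
  moreover have "((\<lambda>x. flat_exp p (c * x - 1) * flat_exp q (2 - c * x)) has_real_derivative f' x) (at x)" for x
    unfolding D_def f'_def
    by (auto intro!: derivative_eq_intros flat_exp_has_derivative[THEN DERIV_chain2])
      (simp add: flat_exp_def algebra_simps)
  ultimately show ?case
    by (intro bexI[of _ f'] allI)
next
  case (add f g)
  then obtain f' g' where "f' \<in> bump_span c" "g' \<in> bump_span c"
    and "\<And>x. (f has_real_derivative f' x) (at x)" "\<And>x. (g has_real_derivative g' x) (at x)"
    by blast
  then show ?case
    by (intro bexI[of _ "\<lambda>x. f' x + g' x"] allI DERIV_add bump_span.add)
qed

lemma bump_span_iterated_deriv:
  assumes "f \<in> bump_span c"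
  shows "(deriv ^^ n) f \<in> bump_span c"
proof (induction n)
  case (Suc n)
  then obtain f' where f': "f' \<in> bump_span c" "\<And>x. ((deriv ^^ n) f has_real_derivative f' x) (at x)"
    using bump_span_has_derivative by blast
  have "(deriv ^^ Suc n) f = f'"
    using f'(2) by (auto simp: DERIV_imp_deriv)
  then show ?case using f'(1) by simp
qed (use assms in simp)

text \<open>This is the dilated bump \<open>\<psi>(c x)\<close>, positive exactly where
  \<open>1 < c * x\<close> and \<open>c * x < 2\<close>.\<close>

definition bump :: "real \<Rightarrow> real \<Rightarrow> real"
  where "bump c x = flat_exp 1 (c * x - 1) * flat_exp 1 (2 - c * x)"

lemma bump_nonneg: "0 \<le> bump c x"
  by (simp add: bump_def flat_exp_def)

lemma bump_le_1: "bump c x \<le> 1"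
  by (auto simp: bump_def flat_exp_def intro!: mult_le_one)

lemma bump_eq_0: "c > 0 \<Longrightarrow> x \<notin> {1 / c<..<2 / c} \<Longrightarrow> bump c x = 0"
  by (auto simp: bump_def flat_exp_def field_simps)

text \<open>On the middle half of the support both arguments of \<open>flat_exp\<close> are at least
  \<open>1 / 4\<close>, so each factor is at least \<open>exp (- 4)\<close>.\<close>

lemma bump_ge:
  assumes "c > 0" "x \<in> {5 / (4 * c)..7 / (4 * c)}"
  shows "exp (- 8) \<le> bump c x"
proof -
  have *: "exp (- 4) \<le> flat_exp 1 y" if "y \<ge> 1 / 4" for y
    using that by (auto simp: flat_exp_def field_simps)
  have "exp (- 4) * exp (- 4) \<le> bump c x"
    unfolding bump_def using assms by (intro mult_mono *) (auto simp: field_simps flat_exp_def)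
  then show ?thesis by (simp flip: exp_add)
qed

lemma test_function_bump:
  assumes "c > 0"
  shows "test_function (bump c)"
  unfolding test_function_def
proof (intro conjI allI)
  fix n x
  have "bump c \<in> bump_span c"
    unfolding bump_def by (rule bump_span.product)
  then show "(deriv ^^ n) (bump c) differentiable at x"
    using bump_span_has_derivative[OF bump_span_iterated_deriv] real_differentiable_def by blast
next
  have "{x. bump c x \<noteq> 0} \<subseteq> {1 / c..2 / c}"
    using bump_eq_0[OF assms] greaterThanLessThan_subseteq_atLeastAtMost_iff[of "1 / c" "2 / c" "1 / c" "2 / c"]
    by blast
  then have "bounded {x. bump c x \<noteq> 0}"
    using bounded_closed_interval bounded_subset by blast
  then show "compact (closure {x. bump c x \<noteq> 0})"
    by simp
qed

section \<open>Weak derivatives of smooth functions\<close>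

text \<open>The boundary terms vanish because \<open>\<phi>\<close> is 0 at both endpoints.
  Regularity of \<open>G\<close> is asked for on \<open>{a..b}\<close> only, so that a function
  singular at 0 can be paired with a bump supported in the positive half-line.\<close>

lemma integral_by_parts_compact_support:
  fixes \<phi> \<phi>' G G' :: "real \<Rightarrow> real"
  assumes ab: "a < b"
    and \<phi>: "\<And>x. (\<phi> has_real_derivative \<phi>' x) (at x)" "continuous_on {a..b} \<phi>'"
    and zero: "\<And>x. x \<notin> {a<..<b} \<Longrightarrow> \<phi> x = 0"
    and G: "\<And>x. x \<in> {a..b} \<Longrightarrow> (G has_real_derivative G' x) (at x within {a..b})" "continuous_on {a..b} G'"
  shows "(LINT x|lebesgue. \<phi>' x * G x) = - (LINT x|lebesgue. \<phi> x * G' x)"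
    and "integrable lebesgue (\<lambda>x. \<phi> x * G' x)"
proof -
  have zero': "\<phi>' x = 0" if "x \<notin> {a..b}" for x
  proof -
    have "((\<lambda>_. 0) has_real_derivative \<phi>' x) (at x)"
      by (rule has_field_derivative_transform_within_open[OF \<phi>(1), where S = "- {a..b}"])
        (use that zero in auto)
    then show ?thesis
      using DERIV_unique DERIV_const by blast
  qed
  have cont: "continuous_on {a..b} \<phi>" "continuous_on {a..b} G"
    using DERIV_continuous_on[OF has_field_derivative_at_within[OF \<phi>(1)]] DERIV_continuous_on[OF G(1)] by auto
  have int: "set_integrable lebesgue {a..b} (\<lambda>x. \<phi>' x * G x)" "set_integrable lebesgue {a..b} (\<lambda>x. \<phi> x * G' x)"
    using cont \<phi> G by (auto intro!: absolutely_integrable_continuous_real continuous_intros)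
  have "\<phi> x = 0" if "x \<notin> {a..b}" for x
    by (rule zero) (use that in auto)
  then have eq: "indicator {a..b} x *\<^sub>R (\<phi>' x * G x) = \<phi>' x * G x"
    "indicator {a..b} x *\<^sub>R (\<phi> x * G' x) = \<phi> x * G' x" for x
    using zero' by (cases "x \<in> {a..b}"; simp)+
  show "integrable lebesgue (\<lambda>x. \<phi> x * G' x)"
    using int(2) unfolding set_integrable_def eq .
  have "((\<lambda>x. \<phi>' x * G x + \<phi> x * G' x) has_integral \<phi> b * G b - \<phi> a * G a) {a..b}"
  proof (rule fundamental_theorem_of_calculus)
    fix x assume x: "x \<in> {a..b}"
    show "((\<lambda>x. \<phi> x * G x) has_vector_derivative \<phi>' x * G x + \<phi> x * G' x) (at x within {a..b})"
      using DERIV_mult[OF has_field_derivative_at_within[OF \<phi>(1)] G(1)[OF x]]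
      by (simp add: has_real_derivative_iff_has_vector_derivative algebra_simps)
  qed (use ab in simp)
  then have "integral {a..b} (\<lambda>x. \<phi>' x * G x + \<phi> x * G' x) = 0"
    using zero by (simp add: integral_unique)
  then have "integral {a..b} (\<lambda>x. \<phi>' x * G x) + integral {a..b} (\<lambda>x. \<phi> x * G' x) = 0"
    using int by (subst (asm) Henstock_Kurzweil_Integration.integral_add) (auto dest: set_lebesgue_integral_eq_integral)
  then show "(LINT x|lebesgue. \<phi>' x * G x) = - (LINT x|lebesgue. \<phi> x * G' x)"
    using int[THEN set_lebesgue_integral_eq_integral(2)]
    by (simp add: set_lebesgue_integral_def eq del: real_scaleR_def)
qed

section \<open>Test functions and repeated integration by parts\<close>

lemma test_function_deriv:
  assumes "test_function \<phi>"
  shows "((deriv ^^ n) \<phi> has_real_derivative (deriv ^^ Suc n) \<phi> x) (at x)"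
    and "continuous_on S ((deriv ^^ n) \<phi>)"
proof -
  have *: "((deriv ^^ n) \<phi> has_real_derivative (deriv ^^ Suc n) \<phi> x) (at x)" for n x
    using assms DERIV_deriv_iff_real_differentiable by (auto simp: test_function_def)
  show "((deriv ^^ n) \<phi> has_real_derivative (deriv ^^ Suc n) \<phi> x) (at x)"
    by (rule *)
  show "continuous_on S ((deriv ^^ n) \<phi>)"
    by (intro DERIV_continuous_on[OF has_field_derivative_at_within[OF *]])
qed

lemma test_function_support:
  assumes "test_function \<phi>"
  obtains a b where "a < b" "\<forall>n. \<forall>x. x \<notin> {a<..<b} \<longrightarrow> (deriv ^^ n) \<phi> x = 0"
proof -
  have "bounded {x. \<phi> x \<noteq> 0}"
    using assms bounded_subset[OF compact_imp_bounded closure_subset] by (auto simp: test_function_def)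
  then obtain r where r: "r > 0" "\<And>x. \<phi> x \<noteq> 0 \<Longrightarrow> \<bar>x\<bar> \<le> r"
    by (auto simp: bounded_pos)
  have "(deriv ^^ n) \<phi> x = 0" if "\<bar>x\<bar> > r" for n x
    using that
  proof (induction n arbitrary: x)
    case (Suc n)
    have "((\<lambda>_. 0) has_real_derivative (deriv ^^ Suc n) \<phi> x) (at x)"
      by (rule has_field_derivative_transform_within_open[OF test_function_deriv(1)[OF assms], where S = "- {-r..r}"])
        (use Suc in auto)
    then show ?case
      using DERIV_unique DERIV_const by blast
  qed (use r in force)
  then show ?thesis
    \<comment> \<open>Points outside the enlarged interval satisfy the strict inequality
      \<open>\<bar>x\<bar> > r\<close>, so one interval serves all orders.\<close>
    using that[of "- (r + 1)" "r + 1"] r(1) by force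
qed

text \<open>Each integration by parts moves one derivative from \<open>\<phi>\<close> to
  \<open>G\<close> and raises the index of \<open>G\<close>, hence the induction over arbitrary
  \<open>m\<close>.\<close>

lemma iterated_integral_by_parts:
  fixes G :: "nat \<Rightarrow> real \<Rightarrow> real"
  assumes \<phi>: "test_function \<phi>" and G: "\<And>n x. (G n has_real_derivative G (Suc n) x) (at x)"
  shows "(LINT x|lebesgue. (deriv ^^ j) \<phi> x * G m x) = (- 1) ^ j * (LINT x|lebesgue. \<phi> x * G (m + j) x)"
proof (induction j arbitrary: m)
  case (Suc j)
  obtain a b where ab: "a < b" "\<forall>n. \<forall>x. x \<notin> {a<..<b} \<longrightarrow> (deriv ^^ n) \<phi> x = 0"
    by (rule test_function_support[OF \<phi>])
  have "(LINT x|lebesgue. (deriv ^^ Suc j) \<phi> x * G m x) = - (LINT x|lebesgue. (deriv ^^ j) \<phi> x * G (Suc m) x)"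
    by (intro integral_by_parts_compact_support[OF ab(1)] test_function_deriv[OF \<phi>] ab(2)[rule_format]
      has_field_derivative_at_within[OF G] DERIV_continuous_on[OF has_field_derivative_at_within[OF G]])
  also have "\<dots> = (- 1) ^ Suc j * (LINT x|lebesgue. \<phi> x * G (m + Suc j) x)"
    by (simp add: Suc)
  finally show ?case .
qed simp

lemma scaleR_of_real: "a *\<^sub>R of_real b = (of_real (a * b) :: 'a::real_normed_field)"
  by (simp add: scaleR_conv_of_real)

text \<open>The inner product with 1 is a bounded left inverse of \<open>of_real\<close>. Hence both
  integrands are integrable together, and otherwise both integrals take the default value 0.\<close>

lemma lebesgue_integral_of_real:
  "(LINT x|M. of_real (h x) :: 'a::{real_normed_field, euclidean_space}) = of_real (LINT x|M. h x)"
proof (rule integral_bounded_linear'[OF bounded_linear_of_real bounded_linear_inner_left])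
  show "(\<not> (\<forall>x. of_real x = (0 :: 'a))) \<Longrightarrow> \<forall>x. (of_real x :: 'a) \<bullet> 1 = x"
    by (simp add: of_real_def flip: power2_norm_eq_inner)
qed

lemma has_weak_deriv_of_real:
  fixes G :: "nat \<Rightarrow> real \<Rightarrow> real"
  assumes G: "\<And>n x. (G n has_real_derivative G (Suc n) x) (at x)"
  shows "has_weak_deriv j (\<lambda>x. of_real (G 0 x) :: 'a::{real_normed_field, euclidean_space}) (\<lambda>x. of_real (G j x))"
proof -
  have "locally_integrable (\<lambda>x. of_real (G n x) :: 'a)" for n
    unfolding locally_integrable_def
    by (intro allI absolutely_integrable_continuous_real continuous_intros
      DERIV_continuous_on[OF has_field_derivative_at_within[OF G]])
  moreover have "(LINT x|lebesgue. (deriv ^^ j) \<phi> x *\<^sub>R (of_real (G 0 x) :: 'a)) =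
      (- 1) ^ j *\<^sub>R (LINT x|lebesgue. \<phi> x *\<^sub>R of_real (G j x))" if "test_function \<phi>" for \<phi>
    unfolding scaleR_of_real
    by (simp only: lebesgue_integral_of_real iterated_integral_by_parts[where G = G and m = 0, OF that G] scaleR_of_real add_0)
  ultimately show ?thesis
    unfolding has_weak_deriv_def by auto
qed

lemma sobolev_W1_of_real:
  fixes G :: "nat \<Rightarrow> real \<Rightarrow> real"
  assumes "\<And>n x. (G n has_real_derivative G (Suc n) x) (at x)" "\<And>n. integrable lebesgue (G n)"
  shows "(\<lambda>x. of_real (G 0 x) :: 'a::{real_normed_field, euclidean_space}) \<in> sobolev_W1 k"
proof -
  have "(\<lambda>x. of_real (G j x) :: 'a) \<in> L1" for j
    using assms(2) by (simp add: L1_def)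
  moreover have "has_weak_deriv j (\<lambda>x. of_real (G 0 x) :: 'a) (\<lambda>x. of_real (G j x))" for j
    by (rule has_weak_deriv_of_real) (rule assms(1))
  ultimately show ?thesis
    by (auto simp: sobolev_W1_def)
qed

text \<open>
  The successive derivatives of \<open>1 / (1 + x\<^sup>2) = Im (1 / (x - \<i>))\<close>.
\<close>

definition cauchy_deriv :: "nat \<Rightarrow> real \<Rightarrow> real"
  where "cauchy_deriv n x = Im ((- 1) ^ n * fact n / (of_real x - \<i>) ^ Suc n)"

lemma cauchy_deriv_0: "cauchy_deriv 0 x = 1 / (1 + x\<^sup>2)"
  by (simp add: cauchy_deriv_def Im_divide add.commute)

text \<open>The complex function is differentiated at a real point, then restricted to the real
  line, and the imaginary part is taken.\<close>

lemma cauchy_deriv_has_derivative: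
  "(cauchy_deriv n has_real_derivative cauchy_deriv (Suc n) x) (at x)"
proof -
  have nz: "of_real x - \<i> \<noteq> 0"
    by (metis Im_complex_of_real eq_iff_diff_eq_0 imaginary_unit.simps(2) zero_neq_one)
  have "((\<lambda>z. (- 1) ^ n * fact n / (z - \<i>) ^ Suc n) has_field_derivative
      - ((- 1) ^ n * fact n * (of_nat (Suc n) * (of_real x - \<i>) ^ n))
        / ((of_real x - \<i>) ^ Suc n * (of_real x - \<i>) ^ Suc n)) (at (of_real x))"
    using nz by (auto intro!: derivative_eq_intros simp del: of_nat_Suc power_Suc)
  also have "- ((- 1) ^ n * fact n * (of_nat (Suc n) * (of_real x - \<i>) ^ n))
        / ((of_real x - \<i>) ^ Suc n * (of_real x - \<i>) ^ Suc n)
      = (- 1) ^ Suc n * fact (Suc n) / (of_real x - \<i>) ^ Suc (Suc n)"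
    using nz by (simp add: mult_ac del: of_nat_Suc)
  finally have "((\<lambda>z. (- 1) ^ n * fact n / (z - \<i>) ^ Suc n) has_field_derivative
      (- 1) ^ Suc n * fact (Suc n) / (of_real x - \<i>) ^ Suc (Suc n)) (at (of_real x))" .
  from has_vector_derivative_real_field[OF this]
  have "((\<lambda>x. Im ((- 1) ^ n * fact n / (of_real x - \<i>) ^ Suc n)) has_vector_derivative
      cauchy_deriv (Suc n) x) (at x)"
    unfolding cauchy_deriv_def by (rule bounded_linear.has_vector_derivative[OF bounded_linear_Im])
  then show ?thesis
    by (simp add: has_real_derivative_iff_has_vector_derivative cauchy_deriv_def[abs_def])
qed

lemma integrable_inverse_1_plus_square: "integrable lebesgue (\<lambda>x::real. 1 / (1 + x\<^sup>2))"
proof -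
  have "set_integrable lborel (einterval (-\<infinity>) \<infinity>) (\<lambda>x::real. 1 / (1 + x\<^sup>2))"
  proof (rule interval_integral_FTC_nonneg(1)[where F = arctan])
    show "((arctan \<circ> real_of_ereal) \<longlongrightarrow> - (pi / 2)) (at_right (-\<infinity>))"
      using tendsto_arctan_at_bot by (simp add: ereal_tendsto_simps1)
    show "((arctan \<circ> real_of_ereal) \<longlongrightarrow> pi / 2) (at_left \<infinity>)"
      using tendsto_arctan_at_top by (simp add: ereal_tendsto_simps1)
  qed (auto intro!: derivative_eq_intros continuous_intros simp: add_nonneg_eq_0_iff field_simps)
  then show ?thesis
    by (simp add: set_integrable_def integrable_completion)
qed

text \<open>For positive \<open>n\<close> the denominator has modulus at least
  \<open>\<bar>x - \<i>\<bar>\<^sup>2 = 1 + x\<^sup>2\<close>. For \<open>n = 0\<close> the modulus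
  contributes only one power, so the imaginary part is computed exactly.\<close>

lemma cauchy_deriv_bound: "\<bar>cauchy_deriv n x\<bar> \<le> fact n * (1 / (1 + x\<^sup>2))"
proof (cases n)
  case 0
  then show ?thesis by (simp add: cauchy_deriv_0)
next
  case (Suc m)
  have r: "(cmod (of_real x - \<i>))\<^sup>2 = 1 + x\<^sup>2"
    by (simp add: cmod_power2)
  then have "cmod (of_real x - \<i>) \<ge> 1"
    by (metis le_add_same_cancel1 norm_ge_zero one_power2 power2_le_imp_le zero_le_power2)
  then have "1 + x\<^sup>2 \<le> cmod (of_real x - \<i>) ^ Suc n"
    unfolding r[symmetric] by (intro power_increasing) (simp_all add: Suc)
  then have "fact n / cmod (of_real x - \<i>) ^ Suc n \<le> fact n / (1 + x\<^sup>2)"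
    by (intro frac_le) (auto intro: add_pos_nonneg)
  moreover have "\<bar>cauchy_deriv n x\<bar> \<le> cmod ((- 1) ^ n * fact n / (of_real x - \<i>) ^ Suc n)"
    unfolding cauchy_deriv_def by (rule abs_Im_le_cmod)
  ultimately show ?thesis
    by (simp add: norm_divide norm_mult norm_power)
qed

lemma integrable_cauchy_deriv: "integrable lebesgue (cauchy_deriv n)"
proof (rule Bochner_Integration.integrable_bound)
  show "integrable lebesgue (\<lambda>x. fact n * (1 / (1 + x\<^sup>2)) :: real)"
    using integrable_inverse_1_plus_square by (rule integrable_mult_right)
  have "continuous_on UNIV (cauchy_deriv n)"
    by (intro DERIV_continuous_on[OF has_field_derivative_at_within[OF cauchy_deriv_has_derivative]])
  then show "cauchy_deriv n \<in> borel_measurable lebesgue"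
    by (simp add: borel_measurable_continuous_onI measurable_completion)
  show "AE x in lebesgue. norm (cauchy_deriv n x) \<le> norm (fact n * (1 / (1 + x\<^sup>2)) :: real)"
    using cauchy_deriv_bound by (auto intro!: AE_I2)
qed

lemma cauchy_in_sobolev:
  "(\<lambda>x. of_real (1 / (1 + x\<^sup>2)) :: 'a::{real_normed_field, euclidean_space}) \<in> sobolev_W1 k"
  using sobolev_W1_of_real[of cauchy_deriv, OF cauchy_deriv_has_derivative integrable_cauchy_deriv]
  by (simp only: cauchy_deriv_0)

section \<open>Unboundedness on Sobolev spaces\<close>

lemma inverse_not_lebesgue_integrable_atLeast_1: "\<not> set_integrable lebesgue {1..} (\<lambda>x::real. 1 / x)"
proof
  assume *: "set_integrable lebesgue {1..} (\<lambda>x::real. 1 / x)"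
  define I :: real where "I = (LINT x:{1..}|lebesgue. 1 / x)"
  have "ln r \<le> I" if "r \<ge> 1" for r :: real
  proof -
    have sub: "set_integrable lebesgue {1..r} (\<lambda>x. 1 / x)"
      by (rule set_integrable_subset[OF *]) auto
    have "((\<lambda>x. 1 / x) has_integral ln r - ln 1) {1..r}"
      using that by (intro fundamental_theorem_of_calculus)
        (auto intro!: derivative_eq_intros simp flip: has_real_derivative_iff_has_vector_derivative)
    then have "ln r = (LINT x:{1..r}|lebesgue. 1 / x)"
      using set_lebesgue_integral_eq_integral(2)[OF sub] by (simp add: integral_unique)
    also have "\<dots> \<le> I"
      unfolding I_def set_lebesgue_integral_def
      using * sub by (intro integral_mono) (auto simp: set_integrable_def indicator_def)
    finally show ?thesis .
  qed
  \<comment> \<open>The logarithm of this \<open>r\<close> is \<open>\<bar>I\<bar> + 1\<close>,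
    which exceeds \<open>I\<close>.\<close>
  from this[of "exp (\<bar>I\<bar> + 1)"] show False
    by simp
qed

lemma hardy_cauchy:
  fixes f :: "real \<Rightarrow> 'a::{real_normed_field, euclidean_space}"
  assumes x: "x > 0"
  defines "f \<equiv> \<lambda>x. of_real (1 / (1 + x\<^sup>2))"
  shows "hardy f x = Some (of_real (arctan x / x))"
proof -
  have f: "set_integrable lebesgue {0..x} f"
    unfolding f_def by (intro absolutely_integrable_continuous_real continuous_intros)
      (metis add_pos_nonneg less_irrefl zero_le_power2 zero_less_one)
  have f': "set_integrable lebesgue {0<..<x} f"
    by (rule set_integrable_subset[OF f]) auto
  have g: "set_integrable lebesgue {0..x} (\<lambda>x. 1 / (1 + x\<^sup>2))"
    by (intro absolutely_integrable_continuous_real continuous_intros)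
      (metis add_pos_nonneg less_irrefl zero_le_power2 zero_less_one)
  then have g': "set_integrable lebesgue {0<..<x} (\<lambda>x. 1 / (1 + x\<^sup>2))"
    by (rule set_integrable_subset) auto
  have "((\<lambda>x. 1 / (1 + x\<^sup>2)) has_integral arctan x - arctan 0) {0..x}"
    using x by (intro fundamental_theorem_of_calculus)
      (auto intro!: derivative_eq_intros simp: field_simps simp flip: has_real_derivative_iff_has_vector_derivative)
  then have "arctan x = integral {0<..<x} (\<lambda>x. 1 / (1 + x\<^sup>2))"
    by (simp add: integral_unique flip: integral_open_interval_real)
  also have "\<dots> = (LINT x:{0<..<x}|lebesgue. 1 / (1 + x\<^sup>2))"
    using set_lebesgue_integral_eq_integral(2)[OF g'] by simp
  finally have "(LINT x:{0<..<x}|lebesgue. f x) = of_real (arctan x)"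
    unfolding set_lebesgue_integral_def f_def scaleR_of_real lebesgue_integral_of_real by simp
  then show ?thesis
    using x f' hardy_eq_average[of x f]
    by (simp add: interval_lebesgue_integrable_def interval_lebesgue_integral_def zero_ereal_def
        scaleR_of_real)
qed

lemma hardy_unbounded_sobolev:
  "\<not> bounded_operator_on (sobolev_W1 k) (sobolev_W1_norm k)
     (hardy :: (real \<Rightarrow> 'a::{real_normed_field, euclidean_space}) \<Rightarrow> real \<Rightarrow> 'a option)"
proof
  define f :: "real \<Rightarrow> 'a" where "f = (\<lambda>x. of_real (1 / (1 + x\<^sup>2)))"
  assume "bounded_operator_on (sobolev_W1 k) (sobolev_W1_norm k)
     (hardy :: (real \<Rightarrow> 'a) \<Rightarrow> real \<Rightarrow> 'a option)"
  moreover have "f \<in> sobolev_W1 k"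
    unfolding f_def by (rule cauchy_in_sobolev)
  ultimately have "(\<lambda>x. the (hardy f x)) \<in> sobolev_W1 k"
    by (simp add: bounded_operator_on_def)
  \<comment> \<open>For \<open>x \<ge> 1\<close> one has \<open>arctan x \<ge> pi / 4\<close>, so
    this scaling makes the image dominate \<open>1 / x\<close>.\<close>
  then have "integrable lebesgue (\<lambda>x. (4 / pi) *\<^sub>R the (hardy f x))"
    by (simp add: sobolev_W1_def L1_def)
  then have "set_integrable lebesgue {1..} (\<lambda>x. (4 / pi) *\<^sub>R the (hardy f x))"
    unfolding set_integrable_def by (intro integrable_mult_indicator) auto
  then have "set_integrable lebesgue {1..} (\<lambda>x. 1 / x :: real)"
  proof (rule set_integrable_bound)
    show "set_borel_measurable lebesgue {1..} (\<lambda>x. 1 / x :: real)"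
      unfolding set_borel_measurable_def by (rule measurable_completion) measurable
    have "norm (1 / x) \<le> norm ((4 / pi) *\<^sub>R the (hardy f x))" if "x \<ge> 1" for x
    proof -
      have "pi / 4 \<le> arctan x"
        using that arctan_monotone'[of 1 x] by (simp add: arctan_one)
      then have "1 \<le> (4 / pi) * arctan x"
        by (simp add: field_simps)
      then have "1 / x \<le> ((4 / pi) * arctan x) / x"
        using that by (intro divide_right_mono) auto
      moreover have "the (hardy f x) = of_real (arctan x / x)"
        unfolding f_def using that by (subst hardy_cauchy) auto
      ultimately show ?thesis
        using that \<open>pi / 4 \<le> arctan x\<close> by (simp add: scaleR_of_real abs_of_nonneg del: of_real_divide of_real_mult)
    qed
    then show "AE x in lebesgue. x \<in> {1..} \<longrightarrow> norm (1 / x) \<le> norm ((4 / pi) *\<^sub>R the (hardy f x))"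
      by (intro AE_I2) auto
  qed
  then show False
    using inverse_not_lebesgue_integrable_atLeast_1 by blast
qed

section \<open>The adjoint Hardy operator: a logarithmic singularity at 0\<close>

text \<open>The partial fractions \<open>1 / x - x / (1 + x\<^sup>2)\<close> of
  \<open>1 / (x * (1 + x\<^sup>2))\<close> lead to this function, normalised to tend to 0 at
  infinity.\<close>

lemma log_potential_has_derivative:
  fixes x :: real
  assumes "x > 0"
  shows "((\<lambda>x. ln (1 + x\<^sup>2) / 2 - ln x) has_real_derivative - 1 / (x * (1 + x\<^sup>2))) (at x within S)"
proof -
  have pos: "1 + x\<^sup>2 > 0"
    by (simp add: add_pos_nonneg)
  have "((\<lambda>x. ln (1 + x\<^sup>2)) has_real_derivative (2 * x) / (1 + x\<^sup>2)) (at x within S)"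
    using pos by (auto intro!: derivative_eq_intros)
  moreover have "(ln has_real_derivative 1 / x) (at x within S)"
    using assms by (auto intro!: derivative_eq_intros)
  ultimately have "((\<lambda>x. ln (1 + x\<^sup>2) / 2 - ln x) has_real_derivative (2 * x) / (1 + x\<^sup>2) / 2 - 1 / x) (at x within S)"
    by (intro DERIV_diff DERIV_cdivide)
  also have "(2 * x) / (1 + x\<^sup>2) / 2 - 1 / x = - 1 / (x * (1 + x\<^sup>2))"
    using assms pos by (simp add: divide_simps) (simp add: power2_eq_square algebra_simps)
  finally show ?thesis .
qed

lemma adjoint_hardy_cauchy:
  fixes f :: "real \<Rightarrow> 'a::{real_normed_field, euclidean_space}"
  assumes x: "x > 0"
  defines "f \<equiv> \<lambda>x. of_real (1 / (1 + x\<^sup>2))"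
  shows "adjoint_hardy f x = Some (of_real (ln (1 + x\<^sup>2) / 2 - ln x))"
proof -
  have "f \<in> L1"
    using cauchy_in_sobolev[of 0, where 'a = 'a] unfolding f_def sobolev_W1_def by blast
  then have f: "integrable lebesgue f"
    by (simp add: L1_def)
  let ?h = "\<lambda>s::real. 1 / (s * (1 + s\<^sup>2))"
  have pos: "1 + s\<^sup>2 > 0" for s :: real
    by (simp add: add_pos_nonneg)
  let ?F = "\<lambda>s::real. - (ln (1 + s\<^sup>2) / 2 - ln s)"
  have der: "(?F has_real_derivative ?h s) (at s)" if "ereal x < ereal s" for s
  proof -
    have "s > 0" using that x by simp
    from DERIV_minus[OF log_potential_has_derivative[OF this]] show ?thesis
      by simp
  qed
  have cont: "isCont ?h s" if "ereal x < ereal s" for s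
    using that x pos[of s] by (auto intro!: continuous_intros)
  have nonneg: "AE s in lborel. ereal x < ereal s \<longrightarrow> ereal s < \<infinity> \<longrightarrow> 0 \<le> ?h s"
    using x by auto
  have "(?F \<longlongrightarrow> ?F x) (at_right x)"
    using x pos[of x] by (intro tendsto_intros) auto
  then have lim_x: "((?F \<circ> real_of_ereal) \<longlongrightarrow> ?F x) (at_right (ereal x))"
    by (simp add: ereal_tendsto_simps1)
  have "(?F \<longlongrightarrow> 0) at_top"
    by real_asymp
  then have lim_infinity: "((?F \<circ> real_of_ereal) \<longlongrightarrow> 0) (at_left \<infinity>)"
    by (simp add: ereal_tendsto_simps1)
  have h: "(LBINT s=x..\<infinity>. ?h s) = 0 - ?F x"
    by (rule interval_integral_FTC_nonneg(2)[OF _ der cont nonneg lim_x lim_infinity]) simp_all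
  have k: "(\<lambda>s. adjoint_kernel x s *\<^sub>R f s) = (\<lambda>s. of_real (indicator {x<..} s *\<^sub>R ?h s))"
    using x by (auto simp: fun_eq_iff adjoint_kernel_def f_def indicator_def scaleR_conv_of_real)
  have m: "(\<lambda>s. indicator {x<..} s *\<^sub>R ?h s) \<in> borel_measurable lborel"
    by measurable
  have "(LINT s|lebesgue. indicator {x<..} s *\<^sub>R ?h s) = (LBINT s=x..\<infinity>. ?h s)"
    using m by (simp add: interval_lebesgue_integral_def set_lebesgue_integral_def integral_completion)
  then show ?thesis
    unfolding adjoint_hardy_eq_kernel[OF f less_imp_neq[OF x, symmetric]] k lebesgue_integral_of_real
    using h \<open>(LINT s|lebesgue. indicator {x<..} s *\<^sub>R ?h s) = (LBINT s=x..\<infinity>. ?h s)\<close> by simp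
qed

lemma adjoint_hardy_unbounded_sobolev:
  assumes "k > 0"
  shows "\<not> bounded_operator_on (sobolev_W1 k) (sobolev_W1_norm k)
     (adjoint_hardy :: (real \<Rightarrow> 'a::{real_normed_field, euclidean_space}) \<Rightarrow> real \<Rightarrow> 'a option)"
proof
  define f :: "real \<Rightarrow> 'a" where "f = (\<lambda>x. of_real (1 / (1 + x\<^sup>2)))"
  define u where "u = (\<lambda>x. the (adjoint_hardy f x))"
  assume "bounded_operator_on (sobolev_W1 k) (sobolev_W1_norm k)
     (adjoint_hardy :: (real \<Rightarrow> 'a) \<Rightarrow> real \<Rightarrow> 'a option)"
  moreover have "f \<in> sobolev_W1 k"
    unfolding f_def by (rule cauchy_in_sobolev)
  ultimately have "u \<in> sobolev_W1 k"
    by (simp add: bounded_operator_on_def u_def)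
  then have "\<exists>g. integrable lebesgue g \<and> has_weak_deriv 1 u g"
    using assms unfolding sobolev_W1_def L1_def by (auto simp: Suc_le_eq)
  then obtain g where g: "integrable lebesgue g" and weak: "has_weak_deriv 1 u g"
    by auto
  define U where "U = (\<lambda>x::real. ln (1 + x\<^sup>2) / 2 - ln x)"
  have u: "u x = of_real (U x)" if "x > 0" for x
    unfolding u_def f_def U_def by (subst adjoint_hardy_cauchy[OF that]) (rule option.sel)
  have pos: "1 + x\<^sup>2 > 0" for x :: real
    by (simp add: add_pos_nonneg)
  have U: "(U has_real_derivative - 1 / (x * (1 + x\<^sup>2))) (at x within S)" if "x > 0" for x S
    unfolding U_def using that by (rule log_potential_has_derivative)
  \<comment> \<open>The measure \<open>dx / x\<close> is invariant under dilations, so the pairing of \<open>U'\<close> with the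
      dilated bumps does not vanish as the bumps concentrate at 0.\<close>
  have lower: "exp (- 8) / 20 \<le> norm (LINT x|lebesgue. bump c x *\<^sub>R g x)" if c: "c \<ge> 1" for c
  proof -
    have c0: "1 / c < 2 / c" "1 / c > 0"
      using c by (auto simp: field_simps)
    have bd: "(bump c has_real_derivative deriv (bump c) x) (at x)" "continuous_on {1 / c..2 / c} (deriv (bump c))" for x
      using test_function_deriv[OF test_function_bump[of c], of 0]
        test_function_deriv(2)[OF test_function_bump[of c], of _ 1] c by simp_all
    \<comment> \<open>The formula for \<open>u\<close> in terms of \<open>U\<close> is available for
      positive \<open>x\<close> only; on the rest of the line the derivative of the bump removes
      \<open>u\<close> from the pairing.\<close>
    have d0: "deriv (bump c) x = 0" if "x \<le> 0" for x
    proof -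
      have "((\<lambda>_. 0) has_real_derivative deriv (bump c) x) (at x)"
        by (rule has_field_derivative_transform_within_open[OF bd(1), where S = "{..<1 / c}"])
          (use that c bump_eq_0[of c] order.strict_trans1[OF that c0(2)] in auto)
      then show ?thesis
        using DERIV_unique DERIV_const by blast
    qed
    have cont: "continuous_on {1 / c..2 / c} (\<lambda>x. - 1 / (x * (1 + x\<^sup>2)))"
      using c0(2) less_imp_neq[OF pos, THEN not_sym] by (intro continuous_intros) auto
    have zero: "bump c x = 0" if "x \<notin> {1 / c<..<2 / c}" for x
      using bump_eq_0[OF _ that] c by simp
    have U': "(U has_real_derivative - 1 / (x * (1 + x\<^sup>2))) (at x within {1 / c..2 / c})"
      if "x \<in> {1 / c..2 / c}" for x
      using that by (intro U less_le_trans[OF c0(2)]) simp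
    have parts: "(LINT x|lebesgue. deriv (bump c) x * U x) = - (LINT x|lebesgue. bump c x * (- 1 / (x * (1 + x\<^sup>2))))"
      "integrable lebesgue (\<lambda>x. bump c x * (- 1 / (x * (1 + x\<^sup>2))))"
      by (rule integral_by_parts_compact_support[OF c0(1) bd zero U' cont]; assumption)+
    have "(LINT x|lebesgue. (deriv ^^ 1) (bump c) x *\<^sub>R u x) = (- 1) ^ 1 *\<^sub>R (LINT x|lebesgue. bump c x *\<^sub>R g x)"
      using weak test_function_bump[of c] c unfolding has_weak_deriv_def by simp
    then have "(LINT x|lebesgue. bump c x *\<^sub>R g x) = - (LINT x|lebesgue. deriv (bump c) x *\<^sub>R u x)"
      by simp
    also have "(\<lambda>x. deriv (bump c) x *\<^sub>R u x) = (\<lambda>x. of_real (deriv (bump c) x * U x))"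
    proof
      fix x show "deriv (bump c) x *\<^sub>R u x = of_real (deriv (bump c) x * U x)"
        by (cases "x > 0") (simp_all add: u scaleR_of_real d0 del: of_real_mult)
    qed
    finally have eq: "(LINT x|lebesgue. bump c x *\<^sub>R g x) = of_real (LINT x|lebesgue. bump c x * (- 1 / (x * (1 + x\<^sup>2))))"
      by (simp only: lebesgue_integral_of_real parts(1) of_real_minus minus_minus)
    have int: "integrable lebesgue (\<lambda>x. bump c x * (1 / (x * (1 + x\<^sup>2))))"
      using integrable_minus[OF parts(2)] by simp
    let ?J = "{5 / (4 * c)..7 / (4 * c)}"
    \<comment> \<open>The interval \<open>?J\<close> has length \<open>1 / (2 * c)\<close>, which
      cancels the growth of the lower bound \<open>c / 10\<close> for
      \<open>1 / (x * (1 + x\<^sup>2))\<close>.\<close>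
    have "exp (- 8) / 20 = (LINT x|lebesgue. indicator ?J x *\<^sub>R (exp (- 8) * (c / 10)))"
      using c by (simp add: field_simps)
    also have "\<dots> \<le> (LINT x|lebesgue. bump c x * (1 / (x * (1 + x\<^sup>2))))"
    proof (rule integral_mono[OF _ int])
      fix x
      show "indicator ?J x *\<^sub>R (exp (- 8) * (c / 10)) \<le> bump c x * (1 / (x * (1 + x\<^sup>2)))"
      proof (cases "x \<in> ?J")
        case True
        \<comment> \<open>Since \<open>c \<ge> 1\<close>, the factor \<open>1 + x\<^sup>2\<close> is
          at most 5, whence \<open>x * (1 + x\<^sup>2) \<le> 10 / c\<close>.\<close>
        then have x: "0 < x" "x \<le> 2 / c" "2 / c \<le> 2"
          using c by (auto simp: field_simps intro: less_le_trans[of 0 "5 / (4 * c)"])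
        then have "x\<^sup>2 \<le> 2\<^sup>2"
          by (intro power_mono) auto
        then have "x * (1 + x\<^sup>2) \<le> (2 / c) * 5"
          using x c by (intro mult_mono) auto
        then have "c / 10 \<le> 1 / (x * (1 + x\<^sup>2))"
          using divide_left_mono[of "x * (1 + x\<^sup>2)" "(2 / c) * 5" 1] x(1) c pos[of x] by simp
        then have "exp (- 8) * (c / 10) \<le> bump c x * (1 / (x * (1 + x\<^sup>2)))"
          using bump_ge[OF _ True] bump_nonneg[of c x] c by (intro mult_mono) auto
        then show ?thesis
          using True by (simp only: indicator_simps scaleR_one)
      next
        case False
        have "0 \<le> bump c x * (1 / (x * (1 + x\<^sup>2)))"
          using bump_eq_0[of c x] bump_nonneg[of c x] c0(2) c pos[of x]
          by (cases "x > 0") auto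
        then show ?thesis using False by simp
      qed
    qed (intro integrable_scaleR_left integrable_real_indicator; simp add: emeasure_lborel_Icc_eq)
    also have "\<dots> \<le> norm (LINT x|lebesgue. bump c x *\<^sub>R g x)"
      by (simp add: eq del: of_real_minus)
    finally show ?thesis .
  qed
  \<comment> \<open>The index \<open>Suc n\<close> keeps the dilation factor at least 1, as
    \<open>lower\<close> demands.\<close>
  have "(\<lambda>n. LINT x|lebesgue. bump (real (Suc n)) x *\<^sub>R g x) \<longlonglongrightarrow> (LINT x::real|lebesgue. 0 :: 'a)"
  proof (rule integral_dominated_convergence[where w = "\<lambda>x. norm (g x)"])
    have "bump c \<in> borel_measurable lebesgue" if "c > 0" for c
      using test_function_deriv(2)[OF test_function_bump[OF that], of UNIV 0]
      by (simp add: borel_measurable_continuous_onI measurable_completion)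
    then show "(\<lambda>x. bump (real (Suc n)) x *\<^sub>R g x) \<in> borel_measurable lebesgue" for n
      using g by (intro borel_measurable_scaleR) auto
    show "integrable lebesgue (\<lambda>x. norm (g x))"
      using g by (rule integrable_norm)
    show "AE x in lebesgue. norm (bump (real (Suc n)) x *\<^sub>R g x) \<le> norm (g x)" for n
      by (intro AE_I2) (simp add: bump_nonneg bump_le_1 mult_left_le_one_le)
    have "(\<lambda>n. bump (real (Suc n)) x *\<^sub>R g x) \<longlonglongrightarrow> 0" for x
    proof (rule tendsto_eventually)
      \<comment> \<open>The shrinking supports never contain a point \<open>x \<le> 0\<close> and
        eventually lie to the left of any positive \<open>x\<close>.\<close>
      have "\<forall>\<^sub>F n in sequentially. x \<le> 0 \<or> 2 / real (Suc n) < x"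
      proof (cases "x \<le> 0")
        case False
        have "(\<lambda>n. 2 / real (Suc n)) \<longlonglongrightarrow> 0"
          by real_asymp
        then have "\<forall>\<^sub>F n in sequentially. 2 / real (Suc n) < x"
          using False by (auto dest: order_tendstoD(2)[of _ _ _ x])
        then show ?thesis
          by eventually_elim simp
      qed simp
      then show "\<forall>\<^sub>F n in sequentially. bump (real (Suc n)) x *\<^sub>R g x = 0"
      proof eventually_elim
        case (elim n)
        have "0 < 1 / real (Suc n)" by simp
        with elim have "x \<notin> {1 / real (Suc n)<..<2 / real (Suc n)}"
          by (auto simp del: of_nat_Suc)
        then show ?case
          using bump_eq_0[of "real (Suc n)" x] by simp
      qed
    qed
    then show "AE x in lebesgue. (\<lambda>n. bump (real (Suc n)) x *\<^sub>R g x) \<longlonglongrightarrow> 0"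
      by (intro AE_I2)
  qed simp
  then have "(\<lambda>n. norm (LINT x|lebesgue. bump (real (Suc n)) x *\<^sub>R g x)) \<longlonglongrightarrow> 0"
    by (simp add: tendsto_norm_zero_iff)
  then have "exp (- 8) / 20 \<le> (0 :: real)"
    by (rule LIMSEQ_le_const) (use lower in auto)
  then show False by simp
qed

theorem proposition3p1:
  shows "(\<forall>(f :: real \<Rightarrow> 'a::{real_normed_field, euclidean_space}) x.
            x \<noteq> 0 \<longrightarrow> interval_lebesgue_integrable lebesgue 0 (ereal x) f \<longrightarrow>
            hardy f x = Some ((1 / x) *\<^sub>R interval_lebesgue_integral lebesgue 0 (ereal x) f)) \<and>
         (\<forall>k. \<not> bounded_operator_on (sobolev_W1 k) (sobolev_W1_norm k)
                (hardy :: (real \<Rightarrow> 'a) \<Rightarrow> real \<Rightarrow> 'a option)) \<and>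
         bounded_operator_on L1 L1_norm
           (adjoint_hardy :: (real \<Rightarrow> 'a) \<Rightarrow> real \<Rightarrow> 'a option) \<and>
         (\<forall>k>0. \<not> bounded_operator_on (sobolev_W1 k) (sobolev_W1_norm k)
                (adjoint_hardy :: (real \<Rightarrow> 'a) \<Rightarrow> real \<Rightarrow> 'a option))"
  using hardy_eq_average hardy_unbounded_sobolev adjoint_hardy_bounded_L1 adjoint_hardy_unbounded_sobolev
  by blast

end
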